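(* Let $a\in\mathbb{R}$ and $m\in\mathbb{R}\setminus\{0\}$. Consider the planar Kepler–Coulomb problem with mass factor $m$ and center $(0,0)$ in the Euclidean plane with coordinates $(\xi,\eta)$, with energy $$E_{pl}=\tfrac12(\dot\xi^2+\dot\eta^2)-\frac{m}{\sqrt{\xi^2+\eta^2}}.$$ Let $E_{sph}$ be the energy of the corresponding spherical Kepler–Coulomb problem with mass factor $m'=m\sqrt{1+a^2}$, regarded as a function of $(\xi,\eta,\dot\xi,\dot\eta)$ as described in the context. Let $$L=\xi\dot\eta-\eta\dot\xi,\qquad A_\eta=-L\dot\xi-\frac{m\eta}{\sqrt{\xi^2+\eta^2}},\qquad h=-\frac{a}{\sqrt{1+a^2}},\qquad D=L^2-2hA_\eta .$$ Then $\{E_{pl},D\}$ and $\{E_{pl},E_{sph}\}$ are both pairs of functionally independent first integrals of the planar Kepler–Coulomb problem, and the two pairs are equivalent, i.e. the functions of each pair can be expressed as functions of those of the other pair.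
   Context: **Planar problem.** The planar Kepler–Coulomb problem with mass factor $m$ and center $(0,0)$ is $\ddot q=-m\|q\|^{-3}q$, $q=(\xi,\eta)\in\mathbb{R}^2\setminus\{(0,0)\}$. Here $L$ is the angular momentum with respect to the center, and $A_\eta$ is the $\eta$-component of the Laplace–Runge–Lenz vector. **Corresponding spherical problem.** Let $S$ be the unit sphere in $\mathbb{R}^3$, $S_{SH}=S\cap\{z<0\}$ its open southern hemisphere, and $V=\{z=-1\}$. The central projection from the origin is the diffeomorphism $V\to S_{SH}$, $(x,y,-1)\mapsto (1+x^2+y^2)^{-1/2}(x,y,-1)$. The spherical Kepler–Coulomb problem on $S_{SH}$ with mass factor $m'$ and center $Z_1=\bigl(0,\tfrac{a}{\sqrt{1+a^2}},-\tfrac{1}{\sqrt{1+a^2}}\bigr)$ is the mechanical system with the round metric and force function $m'\cot\theta$, where $\theta$ is the angle between the moving particle and $Z_1$; its energy is the kinetic energy minus $m'\cot\theta$. The planar coordinates $(\xi,\eta)$ are related to the chart $V$ by $x=\xi$, $y=\sqrt{1+a^2}\,\eta+a$. The time $\tau$ on the sphere and the time $t$ in the plane are related by $\frac{d}{d\tau}=(1+x^2+y^2)\frac{d}{dt}$. Expressed in $(x,y)$ and the velocities $\dot{}=d/dt$, the spherical energy is $$E_{sph}=\tfrac12\bigl((1+y^2)\dot x^2-2xy\,\dot x\dot y+(1+x^2)\dot y^2\bigr)-m'\,\frac{ay+1}{\sqrt{(y-a)^2+(1+a^2)x^2}},$$ and it becomes a function of $(\xi,\eta,\dot\xi,\dot\eta)$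 via the substitution $x=\xi$, $y=\sqrt{1+a^2}\,\eta+a$, with $(\dot x,\dot y)=(\dot\xi,\sqrt{1+a^2}\,\dot\eta)$. **Independence.** Two functions are functionally independent if their differentials are linearly independent on a dense open subset of the phase space. *)

theory Defs
  imports "HOL-Analysis.Analysis"
begin

text \<open>A state \<open>((\<xi>, \<eta>), (\<xi>', \<eta>'))\<close> consists of a position different from the centre \<open>(0, 0)\<close>
  and a velocity. The product norms on \<^typ>\<open>real \<times> real\<close> and \<^typ>\<open>real \<times> real \<times> real\<close> are the
  Euclidean ones.\<close>

type_synonym state = "(real \<times> real) \<times> (real \<times> real)"

definition phase_space :: "state set" where
  "phase_space = (UNIV - {(0, 0)}) \<times> UNIV"

subsection \<open>The planar Kepler--Coulomb problem\<close>

definition kepler_solution ::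
  "real \<Rightarrow> real set \<Rightarrow> (real \<Rightarrow> real \<times> real) \<Rightarrow> (real \<Rightarrow> real \<times> real) \<Rightarrow> bool" where
  "kepler_solution m I q v \<longleftrightarrow>
     open I \<and> is_interval I \<and>
     (\<forall>t\<in>I. q t \<noteq> (0, 0) \<and>
        (q has_vector_derivative v t) (at t) \<and>
        (v has_vector_derivative (- m / norm (q t) ^ 3) *\<^sub>R q t) (at t))"

definition first_integral :: "real \<Rightarrow> (state \<Rightarrow> real) \<Rightarrow> bool" where
  "first_integral m F \<longleftrightarrow>
     F differentiable_on phase_space \<and>
     (\<forall>I q v. kepler_solution m I q v \<longrightarrow> (\<lambda>t. F (q t, v t)) constant_on I)"

fun planar_energy :: "real \<Rightarrow> state \<Rightarrow> real" where
  "planar_energy m ((\<xi>, \<eta>), (\<xi>', \<eta>')) = (\<xi>'\<^sup>2 + \<eta>'\<^sup>2) / 2 - m / sqrt (\<xi>\<^sup>2 + \<eta>\<^sup>2)"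

fun angular_momentum :: "state \<Rightarrow> real" where
  "angular_momentum ((\<xi>, \<eta>), (\<xi>', \<eta>')) = \<xi> * \<eta>' - \<eta> * \<xi>'"

fun lrl_eta :: "real \<Rightarrow> state \<Rightarrow> real" where
  "lrl_eta m ((\<xi>, \<eta>), (\<xi>', \<eta>')) =
     - angular_momentum ((\<xi>, \<eta>), (\<xi>', \<eta>')) * \<xi>' - m * \<eta> / sqrt (\<xi>\<^sup>2 + \<eta>\<^sup>2)"

definition D_integral :: "real \<Rightarrow> real \<Rightarrow> state \<Rightarrow> real" where
  "D_integral a m p =
     (let h = - a / sqrt (1 + a\<^sup>2) in (angular_momentum p)\<^sup>2 - 2 * h * lrl_eta m p)"

subsection \<open>The corresponding spherical problem\<close>

fun central_projection :: "real \<times> real \<Rightarrow> real \<times> real \<times> real" where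
  "central_projection (x, y) = (1 / sqrt (1 + x\<^sup>2 + y\<^sup>2)) *\<^sub>R (x, y, -1)"

definition sphere_center :: "real \<Rightarrow> real \<times> real \<times> real" where
  "sphere_center a = (0, a / sqrt (1 + a\<^sup>2), - 1 / sqrt (1 + a\<^sup>2))"

text \<open>The angle between two unit vectors.\<close>

definition sphere_angle :: "real \<times> real \<times> real \<Rightarrow> real \<times> real \<times> real \<Rightarrow> real" where
  "sphere_angle P Q = arccos (P \<bullet> Q)"

text \<open>The arguments \<open>(x', y')\<close> are derivatives with respect to the planar time \<open>t\<close>; the factor
  \<open>1 + x\<^sup>2 + y\<^sup>2\<close> converts the velocity of the projected point to the spherical time \<open>\<tau>\<close>.\<close>

fun sphere_velocity :: "real \<times> real \<Rightarrow> real \<times> real \<Rightarrow> real \<times> real \<times> real" where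
  "sphere_velocity (x, y) (x', y') =
     (1 + x\<^sup>2 + y\<^sup>2) *\<^sub>R frechet_derivative central_projection (at (x, y)) (x', y')"

definition spherical_energy_chart ::
  "real \<Rightarrow> real \<Rightarrow> real \<times> real \<Rightarrow> real \<times> real \<Rightarrow> real" where
  "spherical_energy_chart a m' z z' =
     (norm (sphere_velocity z z'))\<^sup>2 / 2
       - m' * cot (sphere_angle (central_projection z) (sphere_center a))"

fun spherical_energy :: "real \<Rightarrow> real \<Rightarrow> state \<Rightarrow> real" where
  "spherical_energy a m' ((\<xi>, \<eta>), (\<xi>', \<eta>')) =
     spherical_energy_chart a m' (\<xi>, sqrt (1 + a\<^sup>2) * \<eta> + a) (\<xi>', sqrt (1 + a\<^sup>2) * \<eta>')"

lemma central_projection_has_derivative: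
  "(central_projection has_derivative
     (\<lambda>(u, v). (1 / sqrt (1 + x\<^sup>2 + y\<^sup>2)) *\<^sub>R (u, v, 0)
        - ((x * u + y * v) / sqrt (1 + x\<^sup>2 + y\<^sup>2) ^ 3) *\<^sub>R (x, y, -1))) (at (x, y))"
proof -
  define n where "n = sqrt (1 + x\<^sup>2 + y\<^sup>2)"
  have pos: "0 < 1 + x\<^sup>2 + y\<^sup>2"
    by (simp add: add_pos_nonneg)
  then have n: "n > 0"
    by (simp add: n_def)
  have eq: "central_projection =
      (\<lambda>p. (1 / sqrt (1 + (fst p)\<^sup>2 + (snd p)\<^sup>2)) *\<^sub>R (fst p, snd p, -1))"
    by (auto simp: fun_eq_iff)
  have g: "((\<lambda>p::real\<times>real. 1 / sqrt (1 + (fst p)\<^sup>2 + (snd p)\<^sup>2)) has_derivative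
          (\<lambda>w. - (x * fst w + y * snd w) / n ^ 3)) (at (x, y))"
    using pos n
    by (auto intro!: derivative_eq_intros simp: fun_eq_iff n_def[symmetric])
       (auto simp: field_simps power3_eq_cube)
  have f: "((\<lambda>p::real\<times>real. (fst p, snd p, -1::real)) has_derivative
          (\<lambda>w. (fst w, snd w, 0))) (at (x, y))"
    by (auto intro!: derivative_eq_intros)
  show ?thesis
    unfolding eq n_def[symmetric]
    by (rule has_derivative_eq_rhs[OF has_derivative_scaleR[OF g f]])
       (auto simp: fun_eq_iff n_def algebra_simps add_divide_distrib diff_divide_distrib)
qed

lemma spherical_energy_chart_eq:
  assumes "(x, y) \<noteq> (0, a)"
  shows "spherical_energy_chart a m' (x, y) (x', y') =
     ((1 + y\<^sup>2) * x'\<^sup>2 - 2 * x * y * x' * y' + (1 + x\<^sup>2) * y'\<^sup>2) / 2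
       - m' * (a * y + 1) / sqrt ((y - a)\<^sup>2 + (1 + a\<^sup>2) * x\<^sup>2)"
proof -
  define N where "N = 1 + x\<^sup>2 + y\<^sup>2"
  define n where "n = sqrt N"
  define S where "S = 1 + a\<^sup>2"
  define s where "s = sqrt S"
  define R where "R = (y - a)\<^sup>2 + S * x\<^sup>2"
  have N: "N > 0" and S: "S > 0"
    by (simp_all add: N_def S_def add_pos_nonneg)
  have n: "n > 0" "n\<^sup>2 = N" and s: "s > 0" "s\<^sup>2 = S"
    using N S by (simp_all add: n_def s_def)
  have R: "R > 0"
    using assms S by (auto simp: R_def intro: add_pos_nonneg add_nonneg_pos)
  have vel: "sphere_velocity (x, y) (x', y') =
      N *\<^sub>R ((1 / n) *\<^sub>R (x', y', 0) - ((x * x' + y * y') / n ^ 3) *\<^sub>R (x, y, -1))"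
    using frechet_derivative_at[OF central_projection_has_derivative[of x y], symmetric]
    by (simp add: N_def n_def)
  have n3: "n ^ 3 = N * n"
    using n by (simp add: power3_eq_cube power2_eq_square)
  define r where "r = x * x' + y * y'"
  have "sphere_velocity (x, y) (x', y') =
      ((N * x' - r * x) / n, (N * y' - r * y) / n, r / n)"
    unfolding vel n3 r_def[symmetric] using n N
    by (simp add: diff_divide_distrib right_diff_distrib)
  then have "(norm (sphere_velocity (x, y) (x', y')))\<^sup>2 =
      ((N * x' - r * x) / n)\<^sup>2 + ((N * y' - r * y) / n)\<^sup>2 + (r / n)\<^sup>2"
    by (simp add: norm_Pair power_divide)
  also have "\<dots> = ((N * x' - r * x)\<^sup>2 + (N * y' - r * y)\<^sup>2 + r\<^sup>2) / N"
    by (simp add: power_divide n add_divide_distrib)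
  also have "(N * x' - r * x)\<^sup>2 + (N * y' - r * y)\<^sup>2 + r\<^sup>2 =
      ((1 + y\<^sup>2) * x'\<^sup>2 - 2 * x * y * x' * y' + (1 + x\<^sup>2) * y'\<^sup>2) * N"
    unfolding N_def r_def by algebra
  finally have kin: "(norm (sphere_velocity (x, y) (x', y')))\<^sup>2 =
      (1 + y\<^sup>2) * x'\<^sup>2 - 2 * x * y * x' * y' + (1 + x\<^sup>2) * y'\<^sup>2"
    using N by simp
  define c where "c = (a * y + 1) / (n * s)"
  have ip: "central_projection (x, y) \<bullet> sphere_center a = c"
    unfolding sphere_center_def central_projection.simps c_def
      N_def[symmetric] n_def[symmetric] S_def[symmetric] s_def[symmetric]
    using n s by (simp add: field_simps)
  have "(n * s)\<^sup>2 - (a * y + 1)\<^sup>2 = R"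
    by (simp add: power_mult_distrib n s N_def S_def R_def) algebra
  moreover have "(n * s)\<^sup>2 > 0"
    using n s by simp
  ultimately have c2: "1 - c\<^sup>2 = R / (n * s)\<^sup>2"
    unfolding c_def power_divide by (metis diff_divide_distrib divide_self less_irrefl)
  then have "c\<^sup>2 < 1"
    using R n s by (smt (verit) divide_pos_pos mult_pos_pos zero_less_power)
  then have c: "-1 < c" "c < 1"
    by (simp_all add: abs_square_less_1 abs_less_iff)
  have "cot (arccos c) = c / sqrt (1 - c\<^sup>2)"
    using c by (simp add: cot_def sin_arccos)
  also have "\<dots> = (a * y + 1) / sqrt R"
    unfolding c2 using n s R by (simp add: c_def real_sqrt_divide)
  finally show ?thesis
    unfolding spherical_energy_chart_def kin sphere_angle_def ip R_def S_def by simp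
qed

subsection \<open>Independence and equivalence\<close>

definition functionally_independent :: "(state \<Rightarrow> real) \<Rightarrow> (state \<Rightarrow> real) \<Rightarrow> bool" where
  "functionally_independent F G \<longleftrightarrow>
     (\<exists>U. open U \<and> U \<subseteq> phase_space \<and> phase_space \<subseteq> closure U \<and>
        (\<forall>p\<in>U. F differentiable (at p) \<and> G differentiable (at p) \<and>
           (\<forall>\<alpha> \<beta>. (\<forall>w. \<alpha> * frechet_derivative F (at p) w
                         + \<beta> * frechet_derivative G (at p) w = 0)
              \<longrightarrow> \<alpha> = 0 \<and> \<beta> = 0)))"

text \<open>On the phase space, \<open>H\<close> is a differentiable function of \<open>F\<close> and \<open>G\<close>.\<close>

definition expressible_by ::
  "(state \<Rightarrow> real) \<Rightarrow> (state \<Rightarrow> real) \<Rightarrow> (state \<Rightarrow> real) \<Rightarrow> bool" where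
  "expressible_by F G H \<longleftrightarrow>
     (\<exists>\<Phi> :: real \<times> real \<Rightarrow> real.
        \<forall>p\<in>phase_space. \<Phi> differentiable (at (F p, G p)) \<and> H p = \<Phi> (F p, G p))"

definition equivalent_pairs ::
  "(state \<Rightarrow> real) \<times> (state \<Rightarrow> real) \<Rightarrow> (state \<Rightarrow> real) \<times> (state \<Rightarrow> real) \<Rightarrow> bool" where
  "equivalent_pairs = (\<lambda>(F, G) (F', G').
     expressible_by F G F' \<and> expressible_by F G G' \<and>
     expressible_by F' G' F \<and> expressible_by F' G' G)"

end

theory Submission
  imports Defs
begin

text \<open>The two pairs are related linearly: on the phase space
  \<open>E\<^sub>s\<^sub>p\<^sub>h = (1 + a\<^sup>2) (E\<^sub>p\<^sub>l + D / 2)\<close>. Hence it suffices to treat \<open>{E\<^sub>p\<^sub>l, D}\<close>.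
  The velocity minor of the Jacobian of that pair is twice a polynomial in the state which, along
  every line of direction \<open>((1, 0), (1, 1))\<close>, is monic of degree 4 in the parameter; so it
  vanishes only on a nowhere dense set.\<close>

section \<open>Criteria for first integrals and for functional independence\<close>

lemma open_phase_space: "open phase_space"
  unfolding phase_space_def by (intro open_Times open_Diff) auto

lemma phase_space_iff [simp]: "((x, y), w) \<in> phase_space \<longleftrightarrow> (x, y) \<noteq> (0, 0)"
  by (auto simp: phase_space_def)

fun kepler_field :: "real \<Rightarrow> state \<Rightarrow> state" where
  "kepler_field m (q, v) = (v, (- m / norm q ^ 3) *\<^sub>R q)"

text \<open>Along a solution the state curve has velocity \<open>kepler_field m (q t, v t)\<close>,
  so by the chain rule and linearity of the differential the composite with \<open>F\<close> has
  derivative zero. The time domain is an interval, hence convex, which turns this into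
  constancy.\<close>

lemma first_integralI:
  assumes deriv: "\<And>p. p \<in> phase_space \<Longrightarrow> (F has_derivative F' p) (at p)"
    and zero: "\<And>p. p \<in> phase_space \<Longrightarrow> F' p (kepler_field m p) = 0"
  shows "first_integral m F"
  unfolding first_integral_def
proof (intro conjI allI impI)
  show "F differentiable_on phase_space"
    using deriv by (meson differentiable_at_imp_differentiable_on differentiable_def)
next
  fix I q v
  assume sol: "kepler_solution m I q v"
  have "((\<lambda>t. F (q t, v t)) has_derivative (\<lambda>_. 0)) (at t within I)" if "t \<in> I" for t
  proof -
    have p: "(q t, v t) \<in> phase_space"
      using sol that by (auto simp: kepler_solution_def phase_space_def)
    have "((\<lambda>t. (q t, v t)) has_vector_derivative kepler_field m (q t, v t)) (at t)"
      using sol that by (auto simp: kepler_solution_def intro!: has_vector_derivative_Pair)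
    then have "((\<lambda>t. F (q t, v t)) has_derivative
        (\<lambda>h. F' (q t, v t) (h *\<^sub>R kepler_field m (q t, v t)))) (at t)"
      unfolding has_vector_derivative_def
      by (rule has_derivative_compose[where f = "\<lambda>t. (q t, v t)" and g = F, OF _ deriv[OF p]])
    moreover have "F' (q t, v t) (h *\<^sub>R kepler_field m (q t, v t)) = 0" for h
      using zero[OF p] linear_scale[OF has_derivative_linear[OF deriv[OF p]]]
      by (simp only: scaleR_zero_right)
    ultimately show ?thesis
      by (simp only: has_derivative_at_withinI)
  qed
  moreover have "convex I"
    using sol by (simp add: kepler_solution_def is_interval_convex)
  ultimately show "(\<lambda>t. F (q t, v t)) constant_on I"
    using has_derivative_zero_constant[of I "\<lambda>t. F (q t, v t)"]
    unfolding constant_on_def by blast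
qed

text \<open>A single nonvanishing 2x2 minor of the Jacobian suffices; the two test directions
  \<open>u\<close> and \<open>v\<close> are the same at all points of \<open>U\<close>.\<close>

lemma functionally_independentI:
  assumes "open U" "U \<subseteq> phase_space" "phase_space \<subseteq> closure U"
    and F: "\<And>p. p \<in> U \<Longrightarrow> (F has_derivative F' p) (at p)"
    and G: "\<And>p. p \<in> U \<Longrightarrow> (G has_derivative G' p) (at p)"
    and minor: "\<And>p. p \<in> U \<Longrightarrow> F' p u * G' p v - F' p v * G' p u \<noteq> 0"
  shows "functionally_independent F G"
  unfolding functionally_independent_def
proof (intro exI[of _ U] conjI ballI allI impI)
  fix p assume p: "p \<in> U"
  show "F differentiable at p" "G differentiable at p"
    using F[OF p] G[OF p] by (auto simp: differentiable_def)
  fix \<alpha> \<beta>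
  assume "\<forall>w. \<alpha> * frechet_derivative F (at p) w + \<beta> * frechet_derivative G (at p) w = 0"
  then have *: "\<alpha> * F' p w + \<beta> * G' p w = 0" for w
    using frechet_derivative_at[OF F[OF p]] frechet_derivative_at[OF G[OF p]] by metis
  \<comment> \<open>Cramer's rule: eliminating one coefficient from the equations at
    \<open>u\<close> and \<open>v\<close> leaves the other one times the minor.\<close>
  have "\<alpha> * (F' p u * G' p v - F' p v * G' p u) = 0"
       "\<beta> * (F' p u * G' p v - F' p v * G' p u) = 0"
    using *[of u] *[of v] by algebra+
  then show "\<alpha> = 0" "\<beta> = 0"
    using minor[OF p] by auto
qed fact+

section \<open>Differentials of the planar integrals\<close>

fun planar_energy_deriv :: "real \<Rightarrow> state \<Rightarrow> state \<Rightarrow> real" where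
  "planar_energy_deriv m ((x, y), (x', y')) ((u, w), (u', w')) =
     x' * u' + y' * w' + m * (x * u + y * w) / sqrt (x\<^sup>2 + y\<^sup>2) ^ 3"

fun angular_momentum_deriv :: "state \<Rightarrow> state \<Rightarrow> real" where
  "angular_momentum_deriv ((x, y), (x', y')) ((u, w), (u', w')) =
     u * y' + x * w' - w * x' - y * u'"

fun lrl_eta_deriv :: "real \<Rightarrow> state \<Rightarrow> state \<Rightarrow> real" where
  "lrl_eta_deriv m ((x, y), (x', y')) ((u, w), (u', w')) =
     - (angular_momentum_deriv ((x, y), (x', y')) ((u, w), (u', w')) * x'
        + (x * y' - y * x') * u')
     - m * w / sqrt (x\<^sup>2 + y\<^sup>2) + m * y * (x * u + y * w) / sqrt (x\<^sup>2 + y\<^sup>2) ^ 3"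

text \<open>Since h = -a / sqrt (1 + a^2), the coefficient -2h appears here as
  \<open>2 * (a / sqrt (1 + a\<^sup>2))\<close>.\<close>

definition D_deriv :: "real \<Rightarrow> real \<Rightarrow> state \<Rightarrow> state \<Rightarrow> real" where
  "D_deriv a m p z = 2 * angular_momentum p * angular_momentum_deriv p z
     + 2 * (a / sqrt (1 + a\<^sup>2)) * lrl_eta_deriv m p z"

lemma sum_squares_pos: "(x, y) \<noteq> (0, 0) \<Longrightarrow> 0 < x\<^sup>2 + (y::real)\<^sup>2"
  using sum_power2_gt_zero_iff by blast

text \<open>The inverse radius is the only non-polynomial ingredient of \<open>planar_energy\<close>
  and \<open>lrl_eta\<close>. It is differentiated once here and then kept folded as
  \<open>g\<close>.\<close>

lemma has_derivative_inverse_radius: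
  assumes "(x, y) \<noteq> (0, 0)"
  shows "((\<lambda>p::state. 1 / sqrt ((fst (fst p))\<^sup>2 + (snd (fst p))\<^sup>2)) has_derivative
     (\<lambda>z. - (x * fst (fst z) + y * snd (fst z)) / sqrt (x\<^sup>2 + y\<^sup>2) ^ 3)) (at ((x, y), w))"
proof -
  define r where "r = sqrt (x\<^sup>2 + y\<^sup>2)"
  have pos: "0 < x\<^sup>2 + y\<^sup>2"
    using sum_squares_pos[OF assms] .
  then have "r > 0"
    by (simp add: r_def)
  then show ?thesis
    using pos
    by (auto intro!: derivative_eq_intros simp: fun_eq_iff r_def[symmetric])
       (auto simp: field_simps power3_eq_cube)
qed

lemma planar_energy_has_derivative:
  assumes "p \<in> phase_space"
  shows "(planar_energy m has_derivative planar_energy_deriv m p) (at p)"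
proof -
  obtain x y x' y' where p: "p = ((x, y), (x', y'))" by (metis surj_pair)
  define g where "g = (\<lambda>p::state. 1 / sqrt ((fst (fst p))\<^sup>2 + (snd (fst p))\<^sup>2))"
  note g = has_derivative_inverse_radius[of x y "(x', y')", folded g_def]
  have eq: "planar_energy m = (\<lambda>p. ((fst (snd p))\<^sup>2 + (snd (snd p))\<^sup>2) / 2 - m * g p)"
    by (auto simp: fun_eq_iff g_def)
  show ?thesis
    unfolding eq p using assms
    by (auto simp: p fun_eq_iff algebra_simps diff_divide_distrib add_divide_distrib
        intro!: derivative_eq_intros g)
qed

lemma angular_momentum_has_derivative:
  "(angular_momentum has_derivative angular_momentum_deriv p) (at p)"
proof -
  obtain x y x' y' where p: "p = ((x, y), (x', y'))" by (metis surj_pair)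
  have eq: "angular_momentum =
      (\<lambda>p. fst (fst p) * snd (snd p) - snd (fst p) * fst (snd p))"
    by (auto simp: fun_eq_iff)
  show ?thesis
    unfolding eq p
    by (auto simp: fun_eq_iff algebra_simps intro!: derivative_eq_intros)
qed

lemma lrl_eta_has_derivative:
  assumes "p \<in> phase_space"
  shows "(lrl_eta m has_derivative lrl_eta_deriv m p) (at p)"
proof -
  obtain x y x' y' where p: "p = ((x, y), (x', y'))" by (metis surj_pair)
  define g where "g = (\<lambda>p::state. 1 / sqrt ((fst (fst p))\<^sup>2 + (snd (fst p))\<^sup>2))"
  note g = has_derivative_inverse_radius[of x y "(x', y')", folded g_def]
  have eq: "lrl_eta m = (\<lambda>p. - angular_momentum p * fst (snd p) - m * (snd (fst p) * g p))"
    by (auto simp: fun_eq_iff g_def algebra_simps)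
  have "g ((x, y), (x', y')) = 1 / sqrt (x\<^sup>2 + y\<^sup>2)"
    by (simp add: g_def)
  then show ?thesis
    unfolding eq p using assms
    by (auto simp: p fun_eq_iff algebra_simps diff_divide_distrib add_divide_distrib
        intro!: derivative_eq_intros g angular_momentum_has_derivative)
qed

lemma D_integral_has_derivative:
  assumes "p \<in> phase_space"
  shows "(D_integral a m has_derivative D_deriv a m p) (at p)"
proof -
  define k where "k = a / sqrt (1 + a\<^sup>2)"
  have eq: "D_integral a m = (\<lambda>p. (angular_momentum p)\<^sup>2 + 2 * k * lrl_eta m p)"
    by (simp add: fun_eq_iff D_integral_def Let_def k_def)
  show ?thesis
    unfolding eq
    by (auto simp: fun_eq_iff D_deriv_def k_def[symmetric]
        intro!: derivative_eq_intros angular_momentum_has_derivative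
          lrl_eta_has_derivative[OF assms])
qed

section \<open>The spherical energy as a linear combination of the planar integrals\<close>

lemma spherical_energy_eq:
  assumes "p \<in> phase_space"
  shows "spherical_energy a (m * sqrt (1 + a\<^sup>2)) p =
     (1 + a\<^sup>2) * (planar_energy m p + D_integral a m p / 2)"
proof -
  obtain x y x' y' where p: "p = ((x, y), (x', y'))" by (metis surj_pair)
  define s where "s = sqrt (1 + a\<^sup>2)"
  define r where "r = sqrt (x\<^sup>2 + y\<^sup>2)"
  have s: "s > 0" "1 + a\<^sup>2 = s\<^sup>2"
    by (simp_all add: s_def add_pos_nonneg)
  have r: "r > 0"
    using assms sum_squares_pos[of x y] by (simp add: p r_def)
  \<comment> \<open>The affine change of chart sends the planar center to (0, a) and turns the root
    in the spherical potential into a multiple of the planar radius.\<close>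
  have "(s * y + a - a)\<^sup>2 + (1 + a\<^sup>2) * x\<^sup>2 = s\<^sup>2 * (x\<^sup>2 + y\<^sup>2)"
    unfolding s(2) by algebra
  then have root: "sqrt ((s * y + a - a)\<^sup>2 + (1 + a\<^sup>2) * x\<^sup>2) = s * r"
    using s by (simp add: real_sqrt_mult r_def)
  \<comment> \<open>With L the angular momentum, the right side is s^2 (|v|^2 + L^2) - 2 a s L x'.
    The last term is 2 a s times the velocity part of \<open>lrl_eta\<close>.\<close>
  have kin: "(1 + (s * y + a)\<^sup>2) * x'\<^sup>2 - 2 * x * (s * y + a) * x' * (s * y')
        + (1 + x\<^sup>2) * (s * y')\<^sup>2
      = s\<^sup>2 * (x'\<^sup>2 + y'\<^sup>2 + (x * y' - y * x')\<^sup>2) - 2 * (a * s) * (x * y' - y * x') * x'"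
    using s(2) by algebra
  \<comment> \<open>The factor s in the spherical mass cancels the s of the root. The numerator then
    splits into the Kepler potential and the position part of \<open>lrl_eta\<close>.\<close>
  have pot: "m * s * (a * (s * y + a) + 1) / (s * r) = s\<^sup>2 * (m / r) + a * s * (m * y / r)"
  proof -
    have eq: "a * (s * y + a) + 1 = s\<^sup>2 + a * s * y"
      using s(2) by algebra
    show ?thesis
      unfolding eq using s(1) r by (simp add: field_simps power2_eq_square)
  qed
  have "(x, s * y + a) \<noteq> (0, a)"
    using assms s by (auto simp: p)
  then have "spherical_energy a (m * s) p =
      (s\<^sup>2 * (x'\<^sup>2 + y'\<^sup>2 + (x * y' - y * x')\<^sup>2) - 2 * (a * s) * (x * y' - y * x') * x') / 2
        - (s\<^sup>2 * (m / r) + a * s * (m * y / r))"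
    by (simp only: p spherical_energy.simps s_def[symmetric] spherical_energy_chart_eq
        kin root pot not_False_eq_True)
  also have "\<dots> = s\<^sup>2 * (planar_energy m p + D_integral a m p / 2)"
  proof -
    \<comment> \<open>Here k = -h, and s^2 k = a s matches the coefficient of \<open>lrl_eta\<close>
      on both sides.\<close>
    define k where "k = a / s"
    define M where "M = m / r"
    define N where "N = m * y / r"
    have k: "s\<^sup>2 * k = a * s"
      using s(1) by (simp add: k_def power2_eq_square)
    have E: "planar_energy m p = (x'\<^sup>2 + y'\<^sup>2) / 2 - M"
      by (simp add: p M_def r_def)
    have D: "D_integral a m p = (x * y' - y * x')\<^sup>2 + 2 * k * (- (x * y' - y * x') * x' - N)"
      by (simp add: p D_integral_def Let_def k_def s_def N_def r_def)
    show ?thesis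
      unfolding E D M_def[symmetric] N_def[symmetric] k[symmetric] by (simp add: field_simps)
  qed
  finally show ?thesis
    by (simp only: s_def[symmetric] s(2)[symmetric])
qed

text \<open>The linear relation is known on \<open>phase_space\<close> only. That set is open and
  derivatives are local, so the differential carries over.\<close>

lemma spherical_energy_has_derivative:
  assumes "p \<in> phase_space"
  shows "(spherical_energy a (m * sqrt (1 + a\<^sup>2)) has_derivative
     (\<lambda>z. (1 + a\<^sup>2) * (planar_energy_deriv m p z + D_deriv a m p z / 2))) (at p)"
proof (rule has_derivative_transform_within_open[OF _ open_phase_space assms])
  show "((\<lambda>p. (1 + a\<^sup>2) * (planar_energy m p + D_integral a m p / 2)) has_derivative
     (\<lambda>z. (1 + a\<^sup>2) * (planar_energy_deriv m p z + D_deriv a m p z / 2))) (at p)"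
    by (auto intro!: derivative_eq_intros planar_energy_has_derivative[OF assms]
        D_integral_has_derivative[OF assms])
qed (simp add: spherical_energy_eq)

section \<open>Vanishing of the differentials along the Kepler vector field\<close>

lemma planar_energy_deriv_kepler_field:
  "planar_energy_deriv m p (kepler_field m p) = 0"
proof -
  obtain x y x' y' where p: "p = ((x, y), (x', y'))" by (metis surj_pair)
  show ?thesis
    by (simp add: p norm_Pair algebra_simps add_divide_distrib)
qed

lemma angular_momentum_deriv_kepler_field:
  "angular_momentum_deriv p (kepler_field m p) = 0"
proof -
  obtain x y x' y' where p: "p = ((x, y), (x', y'))" by (metis surj_pair)
  show ?thesis
    by (simp add: p)
qed

lemma lrl_eta_deriv_kepler_field:
  assumes "p \<in> phase_space"
  shows "lrl_eta_deriv m p (kepler_field m p) = 0"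
proof -
  obtain x y x' y' where p: "p = ((x, y), (x', y'))" by (metis surj_pair)
  define r where "r = sqrt (x\<^sup>2 + y\<^sup>2)"
  have r: "r > 0" "r\<^sup>2 = x\<^sup>2 + y\<^sup>2"
    using assms sum_squares_pos[of x y] by (simp_all add: p r_def)
  have "lrl_eta_deriv m p (kepler_field m p) =
      (x * y' - y * x') * (m * x) / r ^ 3 - m * y' / r + m * y * (x * x' + y * y') / r ^ 3"
    using angular_momentum_deriv_kepler_field[of p m]
    by (simp add: p norm_Pair r_def[symmetric])
  \<comment> \<open>Expanding by r^2 = x^2 + y^2 brings all three terms over r^3, where the
    numerators cancel.\<close>
  also have "m * y' / r = m * y' * (x\<^sup>2 + y\<^sup>2) / r ^ 3"
    unfolding r(2)[symmetric] using r(1) by (simp add: power2_eq_square power3_eq_cube)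
  also have "(x * y' - y * x') * (m * x) / r ^ 3 - m * y' * (x\<^sup>2 + y\<^sup>2) / r ^ 3
      + m * y * (x * x' + y * y') / r ^ 3 = 0"
    using r(1) by (simp add: field_simps power2_eq_square)
  finally show ?thesis .
qed

lemma D_deriv_kepler_field:
  "p \<in> phase_space \<Longrightarrow> D_deriv a m p (kepler_field m p) = 0"
  by (simp add: D_deriv_def angular_momentum_deriv_kepler_field lrl_eta_deriv_kepler_field)

section \<open>Density of the states with nonzero velocity minor\<close>

fun velocity_minor :: "real \<Rightarrow> state \<Rightarrow> real" where
  "velocity_minor k ((x, y), (x', y')) =
     (x * y' - y * x') * (x * x' + y * y') + k * (x * (y'\<^sup>2 - x'\<^sup>2) - 2 * y * x' * y')"

text \<open>The two test directions change only the velocity, so the derivatives of the potential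
  terms drop out: neither m nor the radius survives, and the minor is polynomial in the
  state.\<close>

lemma velocity_minor_eq:
  "planar_energy_deriv m p ((0, 0), (1, 0)) * D_deriv a m p ((0, 0), (0, 1))
     - planar_energy_deriv m p ((0, 0), (0, 1)) * D_deriv a m p ((0, 0), (1, 0))
   = 2 * velocity_minor (a / sqrt (1 + a\<^sup>2)) p"
proof -
  obtain x y x' y' where p: "p = ((x, y), (x', y'))" by (metis surj_pair)
  define k where "k = a / sqrt (1 + a\<^sup>2)"
  show ?thesis
    unfolding D_deriv_def p k_def[symmetric] by simp algebra
qed

lemma continuous_on_velocity_minor: "continuous_on A (velocity_minor k)"
proof -
  have eq: "velocity_minor k = (\<lambda>p.
     (fst (fst p) * snd (snd p) - snd (fst p) * fst (snd p))
       * (fst (fst p) * fst (snd p) + snd (fst p) * snd (snd p))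
     + k * (fst (fst p) * ((snd (snd p))\<^sup>2 - (fst (snd p))\<^sup>2)
       - 2 * snd (fst p) * fst (snd p) * snd (snd p)))"
    by (auto simp: fun_eq_iff)
  show ?thesis
    unfolding eq by (intro continuous_intros)
qed

text \<open>Along this direction x, x' and y' grow at unit rate and y stays fixed. Both factors of
  the first product become monic quadratics, while the part multiplied by \<open>k\<close> has
  degree at most 2. The leading coefficient is therefore 1 for every \<open>k\<close>, including
  0.\<close>

lemma finite_velocity_minor_zeros_on_line:
  "finite {t. velocity_minor k (p + t *\<^sub>R ((1, 0), (1, 1))) = 0}"
proof -
  obtain x y x' y' where p: "p = ((x, y), (x', y'))" by (metis surj_pair)
  define P where "P =
      [:x * y' - y * x', x + y' - y, 1:] * [:x * x' + y * y', x + x' + y, 1:]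
      + smult k ([:x, 1:] * [:y'\<^sup>2 - x'\<^sup>2, 2 * (y' - x'):]
          - smult (2 * y) ([:x', 1:] * [:y', 1:]))"
  have "coeff P 4 = 1"
    by (simp add: P_def numeral_eq_Suc)
  then have "P \<noteq> 0"
    by auto
  moreover have "velocity_minor k (p + t *\<^sub>R ((1, 0), (1, 1))) = poly P t" for t
    unfolding P_def p by simp algebra
  ultimately show ?thesis
    by (simp add: poly_roots_finite)
qed

definition regular_states :: "real \<Rightarrow> state set" where
  "regular_states k = {p \<in> phase_space. velocity_minor k p \<noteq> 0}"

lemma open_regular_states: "open (regular_states k)"
proof -
  have "open {p. velocity_minor k p \<noteq> 0}"
    by (intro open_Collect_neq continuous_on_velocity_minor continuous_on_const)
  then show ?thesis
    unfolding regular_states_def Collect_conj_eq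
    using open_phase_space by (simp add: open_Int)
qed

lemma phase_space_subset_closure_regular_states: "phase_space \<subseteq> closure (regular_states k)"
proof
  fix p assume p: "p \<in> phase_space"
  define g where "g = (\<lambda>t. p + t *\<^sub>R (((1, 0), (1, 1)) :: state))"
  have lim: "(g \<longlongrightarrow> p) (at 0)"
    unfolding g_def by (rule tendsto_eq_intros refl | simp add: zero_prod_def)+
  have "eventually (\<lambda>t. g t \<in> phase_space) (at 0)"
    using topological_tendstoD[OF lim open_phase_space p] .
  \<comment> \<open>A finite set has no limit points, so some punctured neighbourhood of 0 contains
    no root, even if 0 itself is one.\<close>
  moreover have "eventually (\<lambda>t. t \<notin> {t. velocity_minor k (g t) = 0}) (at 0)"
    using islimpt_finite[OF finite_velocity_minor_zeros_on_line]
    unfolding islimpt_iff_eventually g_def by blast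
  ultimately have "eventually (\<lambda>t. g t \<in> closure (regular_states k)) (at 0)"
    by eventually_elim (simp add: regular_states_def closure_subset[THEN subsetD])
  then show "p \<in> closure (regular_states k)"
    using Lim_in_closed_set[OF closed_closure _ _ lim] by simp
qed

section \<open>Equivalence of the pairs and assembly of the result\<close>

lemma expressible_by_linear:
  assumes "\<And>p. p \<in> phase_space \<Longrightarrow> H p = c * F p + d * G p"
  shows "expressible_by F G H"
  unfolding expressible_by_def
proof (intro exI ballI conjI)
  fix p assume "p \<in> phase_space"
  then show "H p = (\<lambda>w. c * fst w + d * snd w) (F p, G p)"
    by (simp add: assms)
  show "(\<lambda>w::real \<times> real. c * fst w + d * snd w) differentiable at (F p, G p)"
    unfolding differentiable_def
    by (rule exI[of _ "\<lambda>w. c * fst w + d * snd w"]) (auto intro!: derivative_eq_intros)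
qed

theorem proposition2p4:
  fixes a m :: real
  assumes "m \<noteq> 0"
  shows "first_integral m (planar_energy m)
    \<and> first_integral m (D_integral a m)
    \<and> first_integral m (spherical_energy a (m * sqrt (1 + a\<^sup>2)))
    \<and> functionally_independent (planar_energy m) (D_integral a m)
    \<and> functionally_independent (planar_energy m) (spherical_energy a (m * sqrt (1 + a\<^sup>2)))
    \<and> equivalent_pairs (planar_energy m, D_integral a m)
        (planar_energy m, spherical_energy a (m * sqrt (1 + a\<^sup>2)))"
proof (intro conjI)
  define U where "U = regular_states (a / sqrt (1 + a\<^sup>2))"
  have U: "open U" "U \<subseteq> phase_space" "phase_space \<subseteq> closure U"
    using open_regular_states phase_space_subset_closure_regular_states
    by (auto simp: U_def regular_states_def)
  have a: "1 + a\<^sup>2 \<noteq> 0"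
    by (metis add_pos_nonneg less_irrefl zero_le_power2 zero_less_one)
  have minor: "planar_energy_deriv m p ((0, 0), (1, 0)) * D_deriv a m p ((0, 0), (0, 1))
     - planar_energy_deriv m p ((0, 0), (0, 1)) * D_deriv a m p ((0, 0), (1, 0)) \<noteq> 0"
    if "p \<in> U" for p
    using that unfolding velocity_minor_eq by (simp add: U_def regular_states_def)
  show "first_integral m (planar_energy m)"
    by (rule first_integralI[OF planar_energy_has_derivative])
      (simp_all add: planar_energy_deriv_kepler_field)
  show "first_integral m (D_integral a m)"
    by (rule first_integralI[OF D_integral_has_derivative])
      (simp_all add: D_deriv_kepler_field)
  show "first_integral m (spherical_energy a (m * sqrt (1 + a\<^sup>2)))"
    by (rule first_integralI[OF spherical_energy_has_derivative])
      (simp_all add: planar_energy_deriv_kepler_field D_deriv_kepler_field)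
  show "functionally_independent (planar_energy m) (D_integral a m)"
    by (rule functionally_independentI[OF U planar_energy_has_derivative
          D_integral_has_derivative minor]) (use U(2) in auto)
  show "functionally_independent (planar_energy m) (spherical_energy a (m * sqrt (1 + a\<^sup>2)))"
  proof (rule functionally_independentI[OF U planar_energy_has_derivative
        spherical_energy_has_derivative])
    fix p assume p: "p \<in> U"
    let ?E = "planar_energy_deriv m p" and ?D = "D_deriv a m p"
    let ?u = "((0, 0), (1, 0)) :: state" and ?v = "((0, 0), (0, 1)) :: state"
    \<comment> \<open>Adding a multiple of the first row does not affect a determinant: the products
      of two energy differentials cancel, and the minor of the first pair is only rescaled.\<close>
    have "?E ?u * ((1 + a\<^sup>2) * (?E ?v + ?D ?v / 2)) - ?E ?v * ((1 + a\<^sup>2) * (?E ?u + ?D ?u / 2))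
        = (1 + a\<^sup>2) / 2 * (?E ?u * ?D ?v - ?E ?v * ?D ?u)"
      by (simp only: algebra_simps) (simp add: field_simps)
    also have "\<dots> \<noteq> 0"
      using minor[OF p] a by simp
    finally show "?E ?u * ((1 + a\<^sup>2) * (?E ?v + ?D ?v / 2))
        - ?E ?v * ((1 + a\<^sup>2) * (?E ?u + ?D ?u / 2)) \<noteq> 0" .
  qed (use U(2) in auto)
  show "equivalent_pairs (planar_energy m, D_integral a m)
        (planar_energy m, spherical_energy a (m * sqrt (1 + a\<^sup>2)))"
    unfolding equivalent_pairs_def prod.case
  proof (intro conjI)
    show "expressible_by (planar_energy m) (D_integral a m)
        (spherical_energy a (m * sqrt (1 + a\<^sup>2)))"
      by (rule expressible_by_linear[where c = "1 + a\<^sup>2" and d = "(1 + a\<^sup>2) / 2"])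
        (simp add: spherical_energy_eq distrib_left)
    show "expressible_by (planar_energy m) (spherical_energy a (m * sqrt (1 + a\<^sup>2)))
        (D_integral a m)"
      \<comment> \<open>These coefficients come from solving E_sph = (1 + a^2) (E_pl + D / 2) for
        D.\<close>
      by (rule expressible_by_linear[where c = "-2" and d = "2 / (1 + a\<^sup>2)"])
        (use a in \<open>simp add: spherical_energy_eq\<close>)
  \<comment> \<open>The planar energy is the first member of both pairs, so the two remaining goals
    are met by the first projection.\<close>
  qed (rule expressible_by_linear[where c = 1 and d = 0], simp)+
qed

end
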